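(* For every positive integer $n$ and every integer $r>1$, the number $\#\mathrm{col}_r\, THK(3,n)$ of $r$-colorings of $THK(3,n)$ is \[ \#\mathrm{col}_r\, THK(3,n)=\begin{cases}(u_{n-1},r)^2\, r & \text{if } n \text{ is odd},\\ (5u_{n-1},r)\,(u_{n-1},r)\, r & \text{if } n\text{ is even},\end{cases} \] where \[ u_n=\frac{1}{\sqrt5}\left[\left(\frac{1+\sqrt5}{2}\right)^{n+2}-\left(\frac{-1+\sqrt5}{2}\right)^{n}-\left(\frac{1-\sqrt5}{2}\right)^{n+2}+\left(\frac{-1-\sqrt5}{2}\right)^{n}\right]. \]
   Context: "Knot" means a knot or link in 3-space (possibly several components), up to ambient isotopy. $THK(3,n)$ (Turk's head knot on three strands) is the closure of the 3-strand braid $(\sigma_2\sigma_1^{-1})^n\in B_3$. For an integer $r>1$, an $r$-coloring (Fox coloring) of a knot diagram is an assignment of elements of $\mathbb{Z}_r=\mathbb{Z}/r\mathbb{Z}$ to its arcs such that at each crossing $2y-x-z=0$ in $\mathbb{Z}_r$, where $y$ is the color of the over-arc and $x,z$ are the colors of the two under-arcs. Trivial (constant) colorings are included in the count. The number of $r$-colorings does not depend on the diagram chosen, so it is an invariant of the knot. $(a,b)$ denotes the greatest common divisor of positive integers $a,b$; the numbers $u_n$, $n\ge 0$, are integers. *)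

theory Defs
  imports "HOL-Number_Theory.Number_Theory" "HOL-Library.FuncSet"
begin

(* Only the part of a planar link diagram that matters for Fox colorings is recorded:
   its arcs and, for each crossing, the triple (over-arc, under-arc, under-arc).  The order
   of the two under-arcs is irrelevant for colorings. *)
record 'a link_diagram =
  arcs :: "'a set"
  crossings :: "('a \<times> 'a \<times> 'a) set"

(* The elements of Z/rZ are represented by 0, ..., r - 1.  Colorings are functions on the
   set of arcs, made extensional so that counting them is meaningful. *)
definition colorings :: "int \<Rightarrow> 'a link_diagram \<Rightarrow> ('a \<Rightarrow> int) set" where
  "colorings r D = {c \<in> arcs D \<rightarrow>\<^sub>E {0..<r}.
     \<forall>(y, x, z) \<in> crossings D. [2 * c y - c x - c z = 0] (mod r)}"

definition num_colorings :: "int \<Rightarrow> 'a link_diagram \<Rightarrow> nat" where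
  "num_colorings r D = card (colorings r D)"

(* Gen i is the standard braid generator sigma_i and GenInv i its inverse. *)
datatype braid_letter = Gen nat | GenInv nat

type_synonym braid_word = "braid_letter list"

fun gen_index :: "braid_letter \<Rightarrow> nat" where
  "gen_index (Gen i) = i"
| "gen_index (GenInv i) = i"

(* Convention: in sigma_i the strand going from position i to position i + 1 passes over the
   strand going from i + 1 to i; in the inverse it is the other way round.  (The opposite
   convention yields the mirror image, which has equally many colorings.)  The under-strand always runs from over_end to over_start. *)
fun over_start :: "braid_letter \<Rightarrow> nat" where
  "over_start (Gen i) = i"
| "over_start (GenInv i) = i + 1"

fun over_end :: "braid_letter \<Rightarrow> nat" where
  "over_end (Gen i) = i + 1"
| "over_end (GenInv i) = i"

(* A braid word w on m strands is drawn with its t-th letter (t = 0, 1, ...) as the crossing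
   between level t and level t + 1.  The point (i, t) is the strand in position i
   (1 \<le> i \<le> m) at level t.  Two points are joined if the diagram of the closed braid runs
   from the first to the second without going under a crossing; the last rule closes the braid. *)
inductive joined :: "nat \<Rightarrow> braid_word \<Rightarrow> nat \<times> nat \<Rightarrow> nat \<times> nat \<Rightarrow> bool"
  for m :: nat and w :: braid_word where
  straight: "t < length w \<Longrightarrow> i \<in> {1..m} \<Longrightarrow> i \<noteq> gen_index (w ! t) \<Longrightarrow> i \<noteq> gen_index (w ! t) + 1
     \<Longrightarrow> joined m w (i, t) (i, Suc t)"
| over: "t < length w \<Longrightarrow> joined m w (over_start (w ! t), t) (over_end (w ! t), Suc t)"
| closing: "i \<in> {1..m} \<Longrightarrow> joined m w (i, length w) (i, 0)"

definition arc_of :: "nat \<Rightarrow> braid_word \<Rightarrow> nat \<times> nat \<Rightarrow> (nat \<times> nat) set" where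
  "arc_of m w p = {q. equivclp (joined m w) p q}"

(* Meaningful for words whose letters have indices in {1..<m}. *)
definition braid_closure :: "nat \<Rightarrow> braid_word \<Rightarrow> (nat \<times> nat) set link_diagram" where
  "braid_closure m w =
     \<lparr> arcs = arc_of m w ` ({1..m} \<times> {0..length w}),
       crossings = (\<lambda>t. (arc_of m w (over_start (w ! t), t),
                          arc_of m w (over_end (w ! t), t),
                          arc_of m w (over_start (w ! t), Suc t))) ` {..<length w} \<rparr>"

(* The standard diagram of the Turk's head knot on three strands. *)
definition THK3 :: "nat \<Rightarrow> (nat \<times> nat) set link_diagram" where
  "THK3 n = braid_closure 3 (concat (replicate n [Gen 2, GenInv 1]))"

definition u_real :: "nat \<Rightarrow> real" where
  "u_real n = 1 / sqrt 5 *
     (((1 + sqrt 5) / 2) ^ (n + 2) - ((- 1 + sqrt 5) / 2) ^ n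
      - ((1 - sqrt 5) / 2) ^ (n + 2) + ((- 1 - sqrt 5) / 2) ^ n)"

(* u_real is integer-valued (see of_int_u below), so the floor only changes the type. *)
definition u :: "nat \<Rightarrow> int" where
  "u n = \<lfloor>u_real n\<rfloor>"

lemma u_real_eq_fib: "u_real n = of_int (int (fib (n + 2)) + (- 1) ^ n * int (fib n))"
proof -
  define a b :: real where "a = (1 + sqrt 5) / 2" and "b = (1 - sqrt 5) / 2"
  have F: "real (fib k) = (a ^ k - b ^ k) / sqrt 5" for k
    unfolding a_def b_def by (rule fib_closed_form)
  have 1: "(- 1 + sqrt 5) / 2 = (- 1) * b" "(- 1 - sqrt 5) / 2 = (- 1) * a"
    by (simp_all add: a_def b_def field_simps)
  have "u_real n = 1 / sqrt 5 * (a ^ (n + 2) - ((- 1) * b) ^ n - b ^ (n + 2) + ((- 1) * a) ^ n)"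
    unfolding u_real_def 1 by (simp add: a_def b_def)
  also have "\<dots> = (a ^ (n + 2) - b ^ (n + 2)) / sqrt 5 + (- 1) ^ n * ((a ^ n - b ^ n) / sqrt 5)"
    unfolding power_mult_distrib by (simp add: field_simps)
  also have "\<dots> = of_int (int (fib (n + 2)) + (- 1) ^ n * int (fib n))"
    unfolding F[symmetric] by simp
  finally show ?thesis .
qed

lemma of_int_u: "of_int (u n) = u_real n"
  unfolding u_def u_real_eq_fib floor_of_int ..

end

theory Submission
  imports Defs
begin

text \<open>
  In a braid, the colors of the strands below a crossing are determined by those above it.  A word
  in the braid generators therefore acts on \<open>(\<int>/r)\<^sup>m\<close>, and a coloring of the closed braid is the
  same thing as a fixed vector of this action (\<open>bij_betw_colorings_braid_closure\<close>).

  For \<open>\<sigma>\<^sub>2 \<sigma>\<^sub>1\<^sup>-\<^sup>1\<close> the action is \<open>(a, b, c) \<mapsto> (2b - c, 4b - 2c - a, b)\<close>.  It keeps the sum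
  \<open>a - b + c\<close>, and it maps the differences \<open>(x, y) = (a - b, c - b)\<close> to \<open>(x + y, x + 2y)\<close>, which is
  two steps of the Fibonacci recurrence.  Let \<open>g\<close> be the sequence with this recurrence that starts
  with \<open>x, y\<close>.  A vector is fixed by the \<open>n\<close>-th power iff \<open>g\<close> has period \<open>2n\<close> modulo \<open>r\<close>; the third
  coordinate is then restored too, because \<open>b = (a - b + c) - x - y\<close>.

  The difference over a shift by \<open>2n\<close> factors (\<open>fib_recurrence_shift_diff\<close>).  With \<open>F\<close> and \<open>L\<close> the
  Fibonacci and Lucas numbers, \<open>g (m + 2n) - g m\<close> equals \<open>L\<^sub>n g (m + n)\<close> for odd \<open>n\<close> and
  \<open>F\<^sub>n h (m + n)\<close> for even \<open>n\<close>, where \<open>h k = 2 g (k + 1) - g k\<close>.  The number \<open>u (n - 1)\<close> is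
  exactly this factor.  As \<open>g\<close> and \<open>h\<close> both satisfy the recurrence, which can be run backwards,
  divisibility by \<open>r\<close> at the positions \<open>n, n + 1\<close> may be tested at the positions \<open>0, 1\<close>.  In terms of
  \<open>y\<close> and \<open>w = h 0 = 2y - x\<close> this gives \<open>r dvd u w\<close> together with \<open>r dvd u y\<close> for odd \<open>n\<close>, and
  together with \<open>r dvd 5 u y\<close> for even \<open>n\<close>, because \<open>h 1 = 5y - 2w\<close>
  (\<open>fib_recurrence_period_iff\<close>).

  Finally \<open>(a, b, c) \<mapsto> (a - b + c, y, w)\<close> is invertible over the integers, hence modulo \<open>r\<close>, and
  \<open>k z = 0\<close> has \<open>gcd k r\<close> solutions in \<open>\<int>/r\<close>.  The free first coordinate contributes the
  factor \<open>r\<close>.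
\<close>

section \<open>Colorings of a closed braid\<close>

definition letter_action :: "int \<Rightarrow> braid_letter \<Rightarrow> (nat \<Rightarrow> int) \<Rightarrow> nat \<Rightarrow> int" where
  "letter_action r l v =
     v(over_end l := v (over_start l),
       over_start l := (2 * v (over_start l) - v (over_end l)) mod r)"

lemma over_end_neq_over_start: "over_end l \<noteq> over_start l"
  by (cases l) auto

lemma over_ends_in_range:
  assumes "gen_index l \<in> {1..<m}"
  shows "over_start l \<in> {1..m}" "over_end l \<in> {1..m}"
  using assms by (cases l; auto)+

lemma letter_action_closed:
  assumes "gen_index l \<in> {1..<m}" "r > 0" "v \<in> {1..m} \<rightarrow>\<^sub>E {0..<r}"
  shows "letter_action r l v \<in> {1..m} \<rightarrow>\<^sub>E {0..<r}"
  using over_ends_in_range[OF assms(1)] assms(2,3)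
  unfolding letter_action_def by (auto simp: PiE_def Pi_def extensional_def)

lemma fold_letter_action_closed:
  assumes "\<forall>l \<in> set w. gen_index l \<in> {1..<m}" "r > 0" "v \<in> {1..m} \<rightarrow>\<^sub>E {0..<r}"
  shows "fold (letter_action r) w v \<in> {1..m} \<rightarrow>\<^sub>E {0..<r}"
  using assms(1,3)
proof (induction w arbitrary: v)
  case (Cons l w)
  then show ?case using letter_action_closed[OF _ assms(2)] by simp
qed simp

lemma arc_of_joined:
  assumes "joined m w p q"
  shows "arc_of m w p = arc_of m w q"
proof -
  have "equivclp (joined m w) p q" using assms by (rule r_into_equivclp)
  then show ?thesis unfolding arc_of_def
    by (auto intro: equivclp_trans equivclp_sym)
qed

lemma constant_on_arc:
  assumes inv: "\<And>p q. joined m w p q \<Longrightarrow> f p = f q" and "q \<in> arc_of m w p"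
  shows "f q = f p"
proof -
  have "equivclp (joined m w) p q" using assms(2) by (simp add: arc_of_def)
  then show ?thesis
    by (induction rule: equivclp_induct) (use inv in force)+
qed

text \<open>
  The colors at level 0 propagate through the crossings, each of which determines the color of the
  outgoing under-strand, so a coloring is given by them.  The closing strands identify the last
  level with level 0, and this is the only condition on the initial colors.
\<close>

lemma bij_betw_colorings_braid_closure:
  assumes valid: "\<forall>l \<in> set w. gen_index l \<in> {1..<m}" and r: "r > 0"
  shows "bij_betw (\<lambda>c. \<lambda>i\<in>{1..m}. c (arc_of m w (i, 0)))
     (colorings r (braid_closure m w))
     {v \<in> {1..m} \<rightarrow>\<^sub>E {0..<r}. fold (letter_action r) w v = v}"
    (is "bij_betw ?\<Phi> ?C ?V")
proof -
  define level where "level v t = fold (letter_action r) (take t w) v" for v t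
  have level_0: "level v 0 = v" and level_len: "level v (length w) = fold (letter_action r) w v"
    for v by (simp_all add: level_def)
  have level_Suc: "level v (Suc t) = letter_action r (w ! t) (level v t)" if "t < length w" for v t
    using that by (simp add: level_def take_Suc_conv_app_nth)
  have index: "gen_index (w ! t) \<in> {1..<m}" if "t < length w" for t
    using valid that by simp
  have level_closed: "level v t \<in> {1..m} \<rightarrow>\<^sub>E {0..<r}" if "v \<in> {1..m} \<rightarrow>\<^sub>E {0..<r}" for v t
    unfolding level_def
    by (rule fold_letter_action_closed[OF _ r that]) (use valid in \<open>auto dest: in_set_takeD\<close>)
  let ?arc = "arc_of m w"
  have arcs_eq: "arcs (braid_closure m w) = ?arc ` ({1..m} \<times> {0..length w})"
    by (simp add: braid_closure_def)

  have range_c: "c (?arc (i, t)) \<in> {0..<r}"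
    if "c \<in> ?C" "i \<in> {1..m}" "t \<le> length w" for c i t
    using that unfolding colorings_def arcs_eq by (auto simp: PiE_def Pi_def)
  have crossing_c: "[2 * c (?arc (over_start (w ! t), t)) - c (?arc (over_end (w ! t), t))
      - c (?arc (over_start (w ! t), Suc t)) = 0] (mod r)"
    if "c \<in> ?C" "t < length w" for c t
    using that unfolding colorings_def by (auto simp: braid_closure_def)
  have ext_Phi: "?\<Phi> c \<in> {1..m} \<rightarrow>\<^sub>E {0..<r}" if "c \<in> ?C" for c
    using range_c[OF that] by (auto simp: PiE_def Pi_def)
  have determined: "c (?arc (i, t)) = level (?\<Phi> c) t i"
    if c: "c \<in> ?C" and "i \<in> {1..m}" "t \<le> length w" for c i t
  proof -
    define v where "v = ?\<Phi> c"
    have "c (?arc (i, t)) = level v t i"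
      using that(2,3)
    proof (induction t arbitrary: i)
      case 0
      then show ?case by (simp add: level_0 v_def)
    next
      case (Suc t)
      let ?l = "w ! t"
      have t: "t < length w" using Suc.prems by simp
      note ends = over_ends_in_range[OF index[OF t]]
      have IH: "c (?arc (j, t)) = level v t j" if "j \<in> {1..m}" for j
        by (rule Suc.IH[OF that less_imp_le[OF t]])
      consider "i = over_start ?l" | "i = over_end ?l" "i \<noteq> over_start ?l"
        | "i \<noteq> over_start ?l" "i \<noteq> over_end ?l" by blast
      then show ?case
      proof cases
        case 1
        have "[c (?arc (over_start ?l, Suc t))
            = 2 * c (?arc (over_start ?l, t)) - c (?arc (over_end ?l, t))] (mod r)"
          using crossing_c[OF c t] by (auto simp: cong_iff_dvd_diff algebra_simps dvd_diff_commute)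
        then have "c (?arc (over_start ?l, Suc t))
            = (2 * c (?arc (over_start ?l, t)) - c (?arc (over_end ?l, t))) mod r"
          using range_c[OF c ends(1), of "Suc t"] t by (simp add: cong_def)
        then show ?thesis
          using 1 IH[OF ends(1)] IH[OF ends(2)] by (simp add: level_Suc[OF t] letter_action_def)
      next
        case 2
        have "?arc (over_start ?l, t) = ?arc (i, Suc t)"
          unfolding 2(1) by (rule arc_of_joined[OF joined.over[OF t]])
        then show ?thesis
          using 2 IH[OF ends(1)] by (simp add: level_Suc[OF t] letter_action_def)
      next
        case 3
        then have "i \<noteq> gen_index ?l" "i \<noteq> gen_index ?l + 1"
          by (cases ?l; simp)+
        then have "?arc (i, t) = ?arc (i, Suc t)"
          by (intro arc_of_joined joined.straight[OF t Suc.prems(1)])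
        then show ?thesis
          using 3 IH[OF Suc.prems(1)] by (simp add: level_Suc[OF t] letter_action_def)
      qed
    qed
    then show ?thesis by (simp only: v_def)
  qed

  show ?thesis
  proof (rule bij_betwI')
    fix c d assume c: "c \<in> ?C" and d: "d \<in> ?C"
    show "?\<Phi> c = ?\<Phi> d \<longleftrightarrow> c = d"
    proof
      assume eq: "?\<Phi> c = ?\<Phi> d"
      have "c A = d A" if A: "A \<in> arcs (braid_closure m w)" for A
      proof -
        obtain i t where "A = ?arc (i, t)" "i \<in> {1..m}" "t \<le> length w"
          using A unfolding arcs_eq by auto
        then show ?thesis using determined[OF c] determined[OF d] eq by simp
      qed
      then show "c = d"
        using c d unfolding colorings_def by (auto intro: PiE_ext)
    qed simp
  next
    fix c assume c: "c \<in> ?C"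
    have "fold (letter_action r) w (?\<Phi> c) = ?\<Phi> c"
    proof (rule PiE_ext[OF fold_letter_action_closed[OF valid r ext_Phi[OF c]] ext_Phi[OF c]])
      fix i assume i: "i \<in> {1..m}"
      have "?arc (i, length w) = ?arc (i, 0)"
        by (rule arc_of_joined[OF joined.closing[OF i]])
      then show "fold (letter_action r) w (?\<Phi> c) i = ?\<Phi> c i"
        using determined[OF c i, of "length w"] i by (simp add: level_len)
    qed
    then show "?\<Phi> c \<in> ?V" using ext_Phi[OF c] by simp
  next
    fix v assume "v \<in> ?V"
    then have v: "v \<in> {1..m} \<rightarrow>\<^sub>E {0..<r}" and fixed: "fold (letter_action r) w v = v" by auto
    \<comment> \<open>Color each point by propagation.  The result is constant on arcs; at the closing strands
      this is where the vector being fixed is used.\<close>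
    define f where "f p = level v (snd p) (fst p)" for p
    have f_joined: "f p = f q" if "joined m w p q" for p q
      using that
    proof cases
      case (straight t i)
      then have "i \<noteq> over_start (w ! t)" "i \<noteq> over_end (w ! t)"
        by (cases "w ! t"; simp)+
      then show ?thesis using straight by (simp add: f_def level_Suc letter_action_def)
    next
      case (over t)
      then show ?thesis
        using over_end_neq_over_start[of "w ! t"]
        by (simp add: f_def level_Suc letter_action_def)
    next
      case (closing i)
      then show ?thesis by (simp add: f_def level_len level_0 fixed)
    qed
    define c where "c = (\<lambda>A \<in> arcs (braid_closure m w). f (SOME p. p \<in> A))"
    have c_arc: "c (?arc (i, t)) = level v t i" if "i \<in> {1..m}" "t \<le> length w" for i t
    proof -
      have "?arc (i, t) \<in> arcs (braid_closure m w)" using that by (auto simp: arcs_eq)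
      moreover have "(SOME p. p \<in> ?arc (i, t)) \<in> ?arc (i, t)"
        by (rule someI[of _ "(i, t)"]) (simp add: arc_of_def)
      ultimately show ?thesis
        using constant_on_arc[of m w f, OF f_joined] by (simp add: c_def f_def)
    qed
    have "c \<in> arcs (braid_closure m w) \<rightarrow>\<^sub>E {0..<r}"
    proof (rule PiE_I)
      fix A assume "A \<in> arcs (braid_closure m w)"
      then obtain i t where "A = ?arc (i, t)" "i \<in> {1..m}" "t \<le> length w"
        unfolding arcs_eq by auto
      then show "c A \<in> {0..<r}" using c_arc level_closed[OF v, of t] by (auto simp: PiE_def Pi_def)
    qed (simp add: c_def)
    moreover have "[2 * c (?arc (over_start (w ! t), t)) - c (?arc (over_end (w ! t), t))
      - c (?arc (over_start (w ! t), Suc t)) = 0] (mod r)" if t: "t < length w" for t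
    proof -
      note ends = over_ends_in_range[OF index[OF t]]
      have "[2 * x - y - (2 * x - y) mod r = 0] (mod r)" for x y :: int
        by (simp add: cong_def mod_simps)
      then show ?thesis
        using t ends by (simp add: c_arc level_Suc letter_action_def)
    qed
    ultimately have "c \<in> ?C"
      unfolding colorings_def by (auto simp: braid_closure_def)
    moreover have "v = ?\<Phi> c"
      by (rule PiE_ext[OF v ext_Phi[OF \<open>c \<in> ?C\<close>]]) (simp add: c_arc level_0)
    ultimately show "\<exists>c\<in>?C. v = ?\<Phi> c" by blast
  qed
qed

section \<open>Sequences with the Fibonacci recurrence\<close>

lemma fib_recurrence_add:
  fixes g :: "nat \<Rightarrow> int"
  assumes "\<And>k. g (Suc (Suc k)) = g (Suc k) + g k"
  shows "g (m + Suc k) = int (fib k) * g m + int (fib (Suc k)) * g (Suc m)"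
proof (induction k rule: fib.induct)
  case (3 k)
  then show ?case using assms[of "m + Suc k"] by (simp add: algebra_simps)
qed (simp_all add: assms)

lemma u_eq_fib: "u n = int (fib (n + 2)) + (- 1) ^ n * int (fib n)"
  using of_int_u[of n] unfolding u_real_eq_fib of_int_eq_iff .

text \<open>
  Expressing \<open>g (m + n)\<close>, \<open>g (m + n + 1)\<close> and \<open>g (m + 2n)\<close> through \<open>g m\<close> and \<open>g (m + 1)\<close>, the two
  sides agree up to a multiple of \<open>g m\<close>, which vanishes by Cassini's identity.  The factor \<open>u (n - 1)\<close>
  is the Lucas number \<open>fib (n - 1) + fib (n + 1)\<close> for odd \<open>n\<close> and \<open>fib n\<close> for even \<open>n\<close>.
\<close>

lemma fib_recurrence_shift_diff:
  fixes g :: "nat \<Rightarrow> int"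
  assumes rec: "\<And>k. g (Suc (Suc k)) = g (Suc k) + g k" and "n > 0"
  shows "g (m + 2 * n) - g m =
    u (n - 1) * (if odd n then g (m + n) else 2 * g (Suc (m + n)) - g (m + n))"
proof -
  obtain k where n: "n = Suc k" using \<open>n > 0\<close> gr0_conv_Suc by blast
  define p q where "p = int (fib k)" and "q = int (fib (Suc k))"
  note add = fib_recurrence_add[of g, OF rec]
  have g1: "g (m + n) = p * g m + q * g (Suc m)"
    unfolding n p_def q_def by (rule add)
  have g2: "g (Suc (m + n)) = q * g m + (p + q) * g (Suc m)"
    using add[of m "Suc k"] by (simp add: n p_def q_def algebra_simps)
  have "g (m + 2 * n) = p * g (m + n) + q * g (Suc (m + n))"
    using add[of "m + n" k] unfolding n[symmetric] p_def q_def by (simp add: mult_2 add.assoc)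
  then have g3: "g (m + 2 * n) = (p\<^sup>2 + q\<^sup>2) * g m + (2 * p * q + q\<^sup>2) * g (Suc m)"
    unfolding g1 g2 by (simp add: algebra_simps power2_eq_square)
  have cassini: "p * (p + q) - q\<^sup>2 = - ((- 1) ^ k)"
    using fib_Cassini_int[of k] by (simp add: p_def q_def algebra_simps)
  have u: "u (n - 1) = p + q + (- 1) ^ k * p"
    by (simp add: n u_eq_fib p_def q_def)
  show ?thesis
  proof (cases "odd n")
    case True
    then have "(- 1 :: int) ^ k = 1" by (simp add: n)
    then have "u (n - 1) = 2 * p + q" "p * (p + q) - q\<^sup>2 = - 1" using u cassini by simp_all
    moreover have "(p\<^sup>2 + q\<^sup>2) * g m + (2 * p * q + q\<^sup>2) * g (Suc m) - g m
        = (2 * p + q) * (p * g m + q * g (Suc m)) - (p * (p + q) - q\<^sup>2 + 1) * g m"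
      by (simp add: algebra_simps power2_eq_square)
    ultimately have "(p\<^sup>2 + q\<^sup>2) * g m + (2 * p * q + q\<^sup>2) * g (Suc m) - g m
        = u (n - 1) * (p * g m + q * g (Suc m))"
      by simp
    then show ?thesis unfolding g1 g3 by (simp only: True if_True not_False_eq_True)
  next
    case False
    then have "(- 1 :: int) ^ k = - 1" by (simp add: n)
    then have "u (n - 1) = q" "p * (p + q) - q\<^sup>2 = 1" using u cassini by simp_all
    moreover have "(p\<^sup>2 + q\<^sup>2) * g m + (2 * p * q + q\<^sup>2) * g (Suc m) - g m
        = q * (2 * (q * g m + (p + q) * g (Suc m)) - (p * g m + q * g (Suc m)))
          + (p * (p + q) - q\<^sup>2 - 1) * g m"
      by (simp add: algebra_simps power2_eq_square)
    ultimately have "(p\<^sup>2 + q\<^sup>2) * g m + (2 * p * q + q\<^sup>2) * g (Suc m) - g m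
        = u (n - 1) * (2 * (q * g m + (p + q) * g (Suc m)) - (p * g m + q * g (Suc m)))"
      by simp
    then show ?thesis unfolding g1 g2 g3 by (simp only: False if_False)
  qed
qed

text \<open>
  Any two consecutive terms determine their neighbours on both sides by integer linear
  combinations, so the condition on the left does not depend on \<open>n\<close>.
\<close>

lemma fib_recurrence_dvd_iff:
  fixes g :: "nat \<Rightarrow> int"
  assumes rec: "\<And>k. g (Suc (Suc k)) = g (Suc k) + g k"
  shows "r dvd c * g n \<and> r dvd c * g (Suc n) \<longleftrightarrow> r dvd c * g 0 \<and> r dvd c * g 1"
proof (induction n)
  case (Suc n)
  have "c * g (Suc (Suc n)) = c * g n + c * g (Suc n)"
    by (simp add: rec algebra_simps)
  then have "r dvd c * g (Suc n) \<and> r dvd c * g (Suc (Suc n)) \<longleftrightarrow>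
      r dvd c * g n \<and> r dvd c * g (Suc n)"
    by (auto simp: dvd_add_left_iff)
  with Suc show ?case by simp
qed simp

text \<open>
  For even \<open>n\<close> the factor 5 appears because the first two terms of \<open>2 g (k + 1) - g k\<close> depend on
  those of \<open>g\<close> by a matrix of determinant \<open>-5\<close>: with the shift acting as the golden ratio \<open>\<phi>\<close>,
  this is multiplication by \<open>2\<phi> - 1 = \<surd>5\<close>.  In the coordinates \<open>2 g 1 - g 0\<close> and \<open>g 1\<close> each
  condition involves only one unknown, for both parities.
\<close>

lemma fib_recurrence_period_iff:
  fixes g :: "nat \<Rightarrow> int"
  assumes rec: "\<And>k. g (Suc (Suc k)) = g (Suc k) + g k" and n: "n > 0"
  shows "[g (2 * n) = g 0] (mod r) \<and> [g (Suc (2 * n)) = g 1] (mod r) \<longleftrightarrow>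
    r dvd u (n - 1) * (2 * g 1 - g 0) \<and>
    r dvd (if odd n then u (n - 1) else 5 * u (n - 1)) * g 1"
proof -
  let ?u = "u (n - 1)"
  note shift = fib_recurrence_shift_diff[of g, OF rec n]
  show ?thesis
  proof (cases "odd n")
    case True
    have "[g (2 * n) = g 0] (mod r) \<and> [g (Suc (2 * n)) = g 1] (mod r) \<longleftrightarrow>
        r dvd ?u * g n \<and> r dvd ?u * g (Suc n)"
      using shift[of 0] shift[of 1] True by (simp add: cong_iff_dvd_diff)
    also have "\<dots> \<longleftrightarrow> r dvd ?u * g 0 \<and> r dvd ?u * g 1"
      by (rule fib_recurrence_dvd_iff[of g, OF rec])
    also have "\<dots> \<longleftrightarrow> r dvd ?u * (2 * g 1 - g 0) \<and> r dvd ?u * g 1"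
    proof -
      have "?u * (2 * g 1 - g 0) = 2 * (?u * g 1) - ?u * g 0" by (simp add: algebra_simps)
      then show ?thesis by (metis dvd_diff_right_iff dvd_mult)
    qed
    finally show ?thesis using True by simp
  next
    case False
    define h where "h k = 2 * g (Suc k) - g k" for k
    have h_rec: "h (Suc (Suc k)) = h (Suc k) + h k" for k
      by (simp add: h_def rec)
    have "[g (2 * n) = g 0] (mod r) \<and> [g (Suc (2 * n)) = g 1] (mod r) \<longleftrightarrow>
        r dvd ?u * h n \<and> r dvd ?u * h (Suc n)"
      using shift[of 0] shift[of 1] False by (simp add: cong_iff_dvd_diff h_def)
    also have "\<dots> \<longleftrightarrow> r dvd ?u * h 0 \<and> r dvd ?u * h 1"
      by (rule fib_recurrence_dvd_iff[of h, OF h_rec])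
    also have "\<dots> \<longleftrightarrow> r dvd ?u * (2 * g 1 - g 0) \<and> r dvd 5 * ?u * g 1"
    proof -
      have "5 * ?u * g 1 = ?u * h 1 + 2 * (?u * h 0)"
        by (simp add: h_def rec algebra_simps)
      then have "r dvd ?u * h 0 \<Longrightarrow> r dvd 5 * ?u * g 1 \<longleftrightarrow> r dvd ?u * h 1"
        by (simp add: dvd_add_left_iff)
      then show ?thesis by (auto simp: h_def)
    qed
    finally show ?thesis using False by simp
  qed
qed

section \<open>The braid of the Turk's head knot\<close>

lemma fold_concat_replicate: "fold f (concat (replicate n xs)) = (fold f xs) ^^ n"
  by (induction n) (simp_all add: funpow_Suc_right del: funpow.simps(2))

definition turn :: "int \<Rightarrow> (nat \<Rightarrow> int) \<Rightarrow> nat \<Rightarrow> int" where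
  "turn r = fold (letter_action r) [Gen 2, GenInv 1]"

lemma turn_cong:
  "[turn r v 1 = 2 * v 2 - v 3] (mod r)"
  "[turn r v 2 = 4 * v 2 - 2 * v 3 - v 1] (mod r)"
  "[turn r v 3 = v 2] (mod r)"
proof -
  have "turn r v 2 = (2 * ((2 * v 2 - v 3) mod r) - v 1) mod r"
    by (simp add: turn_def letter_action_def)
  also have "\<dots> = (2 * (2 * v 2 - v 3) - v 1) mod r"
    by (metis mod_diff_left_eq mod_mult_right_eq)
  finally show "[turn r v 2 = 4 * v 2 - 2 * v 3 - v 1] (mod r)"
    by (simp add: cong_def algebra_simps)
qed (simp_all add: turn_def letter_action_def cong_def)

fun fib_from :: "int \<Rightarrow> int \<Rightarrow> nat \<Rightarrow> int" where
  "fib_from x y 0 = x"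
| "fib_from x y (Suc 0) = y"
| "fib_from x y (Suc (Suc k)) = fib_from x y (Suc k) + fib_from x y k"

text \<open>
  Relative to the middle strand, the colors of the outer strands are consecutive terms of a
  Fibonacci-type sequence, and each turn advances by two terms.  The alternating sum is the
  eigenvector for the eigenvalue 1 of the transposed action.
\<close>

lemma turn_iterate_cong:
  fixes v :: "nat \<Rightarrow> int"
  defines "g \<equiv> fib_from (v 1 - v 2) (v 3 - v 2)"
  shows "[(turn r ^^ k) v 1 - (turn r ^^ k) v 2 = g (2 * k)] (mod r)"
    and "[(turn r ^^ k) v 3 - (turn r ^^ k) v 2 = g (Suc (2 * k))] (mod r)"
    and "[(turn r ^^ k) v 1 - (turn r ^^ k) v 2 + (turn r ^^ k) v 3 = v 1 - v 2 + v 3] (mod r)"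
proof (induction k)
  case 0
  { case 1 show ?case by (simp add: g_def) }
  { case 2 show ?case by (simp add: g_def) }
  { case 3 show ?case by simp }
next
  case (Suc k)
  let ?z = "(turn r ^^ k) v"
  note T = turn_cong[of r ?z]
  have a: "[turn r ?z 1 - turn r ?z 2 = (?z 1 - ?z 2) + (?z 3 - ?z 2)] (mod r)"
    using cong_diff[OF T(1,2)] by (simp add: algebra_simps)
  have b: "[turn r ?z 3 - turn r ?z 2 = (?z 1 - ?z 2) + 2 * (?z 3 - ?z 2)] (mod r)"
    using cong_diff[OF T(3,2)] by (simp add: algebra_simps)
  have c: "[turn r ?z 1 - turn r ?z 2 + turn r ?z 3 = ?z 1 - ?z 2 + ?z 3] (mod r)"
    using cong_add[OF cong_diff[OF T(1,2)] T(3)] by (simp add: algebra_simps)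
  have g: "g (2 * Suc k) = g (2 * k) + g (Suc (2 * k))"
    "g (Suc (2 * Suc k)) = g (2 * k) + 2 * g (Suc (2 * k))"
    by (simp_all add: g_def)
  { case 1 show ?case
      using cong_trans[OF a cong_add[OF Suc(1,2)]]
      by (simp only: g funpow.simps comp_apply) }
  { case 2 show ?case
      using cong_trans[OF b cong_add[OF Suc(1) cong_scalar_left[OF Suc(2), of 2]]]
      by (simp only: g funpow.simps comp_apply) }
  { case 3 show ?case using cong_trans[OF c Suc(3)] by (simp only: funpow.simps comp_apply) }
qed

lemma turn_fixed_iff:
  assumes r: "r > 0" and n: "n > 0" and v: "v \<in> {1..3} \<rightarrow>\<^sub>E {0..<r}"
  shows "(turn r ^^ n) v = v \<longleftrightarrow>
    r dvd u (n - 1) * (2 * v 3 - v 1 - v 2) \<and>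
    r dvd (if odd n then u (n - 1) else 5 * u (n - 1)) * (v 3 - v 2)"
proof -
  define z where "z = (turn r ^^ n) v"
  define g where "g = fib_from (v 1 - v 2) (v 3 - v 2)"
  have g_rec: "g (Suc (Suc k)) = g (Suc k) + g k" for k by (simp add: g_def)
  have g0: "g 0 = v 1 - v 2" "g 1 = v 3 - v 2" by (simp_all add: g_def)
  note iter = turn_iterate_cong[where r = r and k = n and v = v, folded g_def z_def]
  have z: "z \<in> {1..3} \<rightarrow>\<^sub>E {0..<r}"
    unfolding z_def turn_def fold_concat_replicate[symmetric]
    by (rule fold_letter_action_closed[OF _ r v]) auto
  have "z = v \<longleftrightarrow> [g (2 * n) = g 0] (mod r) \<and> [g (Suc (2 * n)) = g 1] (mod r)"
  proof
    assume "z = v"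
    then show "[g (2 * n) = g 0] (mod r) \<and> [g (Suc (2 * n)) = g 1] (mod r)"
      using cong_sym[OF iter(1)] cong_sym[OF iter(2)] unfolding g0 by simp
  next
    assume "[g (2 * n) = g 0] (mod r) \<and> [g (Suc (2 * n)) = g 1] (mod r)"
    then have x: "[z 1 - z 2 = v 1 - v 2] (mod r)" and y: "[z 3 - z 2 = v 3 - v 2] (mod r)"
      using iter(1,2) unfolding g0 by (blast intro: cong_trans)+
    \<comment> \<open>Subtracting both differences from the invariant alternating sum leaves the middle color.\<close>
    have c2: "[z 2 = v 2] (mod r)"
      using cong_diff[OF iter(3) cong_add[OF x y]] by (simp add: algebra_simps)
    have c1: "[z 1 = v 1] (mod r)" using cong_add[OF x c2] by simp
    have c3: "[z 3 = v 3] (mod r)" using cong_add[OF y c2] by simp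
    show "z = v"
    proof (rule PiE_ext[OF z v])
      fix i :: nat assume i: "i \<in> {1..3}"
      then have "i = 1 \<or> i = 2 \<or> i = 3" by auto
      then have "[z i = v i] (mod r)" using c1 c2 c3 by blast
      then show "z i = v i" using PiE_mem[OF z i] PiE_mem[OF v i] by (simp add: cong_def)
    qed
  qed
  also have "\<dots> \<longleftrightarrow> r dvd u (n - 1) * (2 * g 1 - g 0) \<and>
      r dvd (if odd n then u (n - 1) else 5 * u (n - 1)) * g 1"
    by (rule fib_recurrence_period_iff[of g, OF g_rec n])
  also have "2 * g 1 - g 0 = 2 * v 3 - v 1 - v 2" unfolding g0 by simp
  finally show ?thesis by (simp only: g0 z_def)
qed

section \<open>Counting the solutions\<close>

text \<open>With \<open>d = gcd k r\<close>, the solutions are the \<open>d\<close> multiples of \<open>r div d\<close> below \<open>r\<close>.\<close>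

lemma card_linear_cong_zero:
  fixes k r :: int
  assumes r: "r > 0"
  shows "int (card {x \<in> {0..<r}. r dvd k * x}) = gcd k r"
proof -
  define d where "d = gcd k r"
  have d: "d > 0" using r by (simp add: d_def)
  obtain r' where r': "r = d * r'" unfolding d_def by (meson dvdE gcd_dvd2)
  obtain k' where k': "k = d * k'" unfolding d_def by (meson dvdE gcd_dvd1)
  have "r' > 0" using r d r' zero_less_mult_pos by blast
  have cop: "coprime r' k'"
  proof -
    have "d * gcd k' r' = d" using d gcd_mult_distrib_int[of d k' r']
      by (simp add: d_def[symmetric] k'[symmetric] r'[symmetric])
    then show ?thesis using d by (simp add: coprime_iff_gcd_eq_1 gcd.commute)
  qed
  have dvd: "r dvd k * x \<longleftrightarrow> r' dvd x" for x
  proof -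
    have "r dvd k * x \<longleftrightarrow> r' dvd k' * x" using d by (simp add: r' k' mult.assoc)
    also have "\<dots> \<longleftrightarrow> r' dvd x" using cop by (simp add: coprime_dvd_mult_right_iff)
    finally show ?thesis .
  qed
  have "{x \<in> {0..<r}. r dvd k * x} = (\<lambda>j. r' * j) ` {0..<d}"
  proof (intro equalityI subsetI)
    fix x assume "x \<in> {x \<in> {0..<r}. r dvd k * x}"
    then have x: "0 \<le> x" "x < d * r'" "r' dvd x" by (simp_all add: dvd r'[symmetric])
    then obtain j where j: "x = r' * j" by blast
    have "0 \<le> j" using x(1) \<open>r' > 0\<close> by (simp add: j zero_le_mult_iff)
    moreover have "j < d" using x(2) \<open>r' > 0\<close> by (simp add: j mult.commute)
    ultimately show "x \<in> (\<lambda>j. r' * j) ` {0..<d}" using j by auto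
  next
    fix x assume "x \<in> (\<lambda>j. r' * j) ` {0..<d}"
    then obtain j where "x = r' * j" "j \<in> {0..<d}" by blast
    then have j: "x = r' * j" "0 \<le> j" "j < d" by simp_all
    then have "x < r" using \<open>r' > 0\<close> by (simp add: r' mult.commute)
    then show "x \<in> {x \<in> {0..<r}. r dvd k * x}" using j \<open>r' > 0\<close> by (simp add: dvd)
  qed
  moreover have "inj_on (\<lambda>j. r' * j) {0..<d}" using \<open>r' > 0\<close> by (auto simp: inj_on_def)
  ultimately show ?thesis using d by (simp add: card_image d_def)
qed

lemma dvd_mult_mod_iff: "(r::int) dvd k * (x mod r) \<longleftrightarrow> r dvd k * x"
  by (simp add: dvd_eq_mod_eq_0 mod_simps)

text \<open>
  The substitution \<open>s = a - b + c\<close>, \<open>y = c - b\<close>, \<open>w = 2c - a - b\<close> is unimodular, with inverse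
  \<open>a = s - y\<close>, \<open>b = s - 3y + w\<close>, \<open>c = s - 2y + w\<close>.  It separates the two conditions and leaves
  \<open>s\<close> free.
\<close>

lemma card_solutions:
  fixes A B r :: int
  assumes r: "r > 0"
  shows "int (card {v \<in> {1..3::nat} \<rightarrow>\<^sub>E {0..<r}.
      r dvd A * (2 * v 3 - v 1 - v 2) \<and> r dvd B * (v 3 - v 2)}) = gcd B r * gcd A r * r"
    (is "int (card ?V) = _")
proof -
  define K where "K k = {x \<in> {0..<r}. r dvd k * x}" for k
  define enc where "enc v = ((v 1 - v 2 + v 3) mod r, (v 3 - v 2) mod r, (2 * v 3 - v 1 - v 2) mod r)"
    for v :: "nat \<Rightarrow> int"
  define dec where "dec = (\<lambda>(s, y, w). \<lambda>i\<in>{1..3::nat}.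
      (if i = 1 then s - y else if i = 2 then s - 3 * y + w else s - 2 * y + w) mod r)"
  have in_range: "x mod r = x" if "x \<in> {0..<r}" for x using that by simp
  have mod_inside:
    "(a mod r - b mod r) mod r = (a - b) mod r"
    "(a mod r - b mod r + c mod r) mod r = (a - b + c) mod r"
    "(a mod r - 2 * (b mod r) + c mod r) mod r = (a - 2 * b + c) mod r"
    "(a mod r - 3 * (b mod r) + c mod r) mod r = (a - 3 * b + c) mod r"
    "(2 * (a mod r) - b mod r - c mod r) mod r = (2 * a - b - c) mod r" for a b c
    by (fold cong_def, intro cong_add cong_diff cong_scalar_left; simp)+
  have enc_dec: "enc (dec (s, y, w)) = (s mod r, y mod r, w mod r)" for s y w
    by (simp add: dec_def enc_def mod_inside)
  have bij: "bij_betw enc ?V ({0..<r} \<times> K B \<times> K A)"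
  proof (rule bij_betw_byWitness[where f' = dec])
    show "\<forall>v\<in>?V. dec (enc v) = v"
    proof
      fix v assume "v \<in> ?V"
      then have v: "v \<in> {1..3} \<rightarrow>\<^sub>E {0..<r}" by simp
      show "dec (enc v) = v"
      proof
        fix i
        show "dec (enc v) i = v i"
        proof (cases "i \<in> {1..3}")
          case True
          then have "i = 1 \<or> i = 2 \<or> i = 3" by auto
          then have "dec (enc v) i = v i mod r"
            by (elim disjE; simp add: dec_def enc_def mod_inside; (simp add: algebra_simps)?)
          then show ?thesis using in_range[OF PiE_mem[OF v True]] by simp
        next
          case False
          then show ?thesis
            using PiE_arb[OF v False] unfolding dec_def enc_def
            by (simp only: prod.case restrict_apply if_False)
        qed
      qed
    qed
    show "\<forall>p\<in>{0..<r} \<times> K B \<times> K A. enc (dec p) = p"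
      by (auto simp: enc_dec K_def)
    show "enc ` ?V \<subseteq> {0..<r} \<times> K B \<times> K A"
      using r by (auto simp: enc_def K_def dvd_mult_mod_iff)
    show "dec ` ({0..<r} \<times> K B \<times> K A) \<subseteq> ?V"
    proof (rule image_subsetI)
      fix p assume "p \<in> {0..<r} \<times> K B \<times> K A"
      then obtain s y w where p: "p = (s, y, w)" and y: "y \<in> K B" and w: "w \<in> K A" by blast
      let ?v = "dec (s, y, w)"
      have "(?v 3 - ?v 2) mod r = y mod r" "(2 * ?v 3 - ?v 1 - ?v 2) mod r = w mod r"
        using enc_dec[of s y w] by (simp_all add: enc_def)
      then have "r dvd B * (?v 3 - ?v 2)" "r dvd A * (2 * ?v 3 - ?v 1 - ?v 2)"
        using y w dvd_mult_mod_iff unfolding K_def by (metis (lifting) mem_Collect_eq)+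
      moreover have "?v \<in> {1..3} \<rightarrow>\<^sub>E {0..<r}" using r by (auto simp: dec_def)
      ultimately show "dec p \<in> ?V" unfolding p by blast
    qed
  qed
  have "int (card (K k)) = gcd k r" for k
    unfolding K_def by (rule card_linear_cong_zero[OF r])
  then show ?thesis
    using bij_betw_same_card[OF bij] r by (simp add: card_cartesian_product)
qed

theorem theorem1p1:
  fixes n :: nat and r :: int
  assumes "n > 0" and "r > 1"
  shows "int (num_colorings r (THK3 n)) =
    (if odd n then (gcd (u (n - 1)) r)\<^sup>2 * r
     else gcd (5 * u (n - 1)) r * gcd (u (n - 1)) r * r)"
proof -
  let ?w = "concat (replicate n [Gen 2, GenInv 1])"
  let ?B = "if odd n then u (n - 1) else 5 * u (n - 1)"
  have r: "r > 0" using assms by simp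
  have "num_colorings r (THK3 n) =
      card {v \<in> {1..3} \<rightarrow>\<^sub>E {0..<r}. fold (letter_action r) ?w v = v}"
    unfolding num_colorings_def THK3_def
    by (rule bij_betw_same_card[OF bij_betw_colorings_braid_closure[OF _ r]]) auto
  also have "{v \<in> {1..3} \<rightarrow>\<^sub>E {0..<r}. fold (letter_action r) ?w v = v} =
      {v \<in> {1..3} \<rightarrow>\<^sub>E {0..<r}.
        r dvd u (n - 1) * (2 * v 3 - v 1 - v 2) \<and> r dvd ?B * (v 3 - v 2)}"
    unfolding fold_concat_replicate turn_def[symmetric]
    using turn_fixed_iff[OF r assms(1)] by blast
  also have "int (card \<dots>) = gcd ?B r * gcd (u (n - 1)) r * r"
    by (rule card_solutions[OF r])
  finally show ?thesis by (simp add: power2_eq_square)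
qed

end
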